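(* When $i_k$ is uniformly sampled from $\{1,\dots,m\}$ for the random projection method (RP), and non-uniformly sampled from $\{1,\dots,m\}$ with probabilities $$\frac{\|\nabla f_i(\boldsymbol x^* )\|_2^2}{\sum_{j=1}^m\|\nabla f_j(\boldsymbol x^* )\|_2^2},\qquad i=1,\dots,m,$$ for the non-uniformly random projection method (NRP), the RP and NRP locally converge to a solution $\boldsymbol x^*$ at a linear rate in expectation if $\mathrm{rank}(\boldsymbol U)=n$ and $\boldsymbol x^0\in\mathcal B_\delta(\boldsymbol x^* )$, where $\mathcal B_\delta(\boldsymbol x^* )=\{\boldsymbol x:\|\boldsymbol x-\boldsymbol x^*\|_2<\delta\}$ is a neighborhood of $\boldsymbol x^*$ with some radius $\delta>0$. In particular, let $\{\boldsymbol x^k\}_{k=0,1,\cdots}$ be the sequence generated by the RP or NRP. Then $$\mathbb{E}_{i_k}\left[\|\boldsymbol x^{k+1}-\boldsymbol x^*\|_2\right]<\gamma_{\mathrm{RP}}^{k+1}\|\boldsymbol x^0-\boldsymbol x^*\|_2$$ for the RP and $$\mathbb{E}_{i_k}\left[\|\boldsymbol x^{k+1}-\boldsymbol x^*\|_2\right]<\gamma_{\mathrm{NRP}}^{k+1}\|\boldsymbol x^0-\boldsymbol x^*\|_2$$ for the NRP, where $\gamma_{\mathrm{RP}},\gamma_{\mathrm{NRP}}\in(0,1)$ are the convergence rates of the RP and NRP, respectively. Furthermore, the asymptotic convergence rates are $$\lim_{k\to\infty}\gamma_{\mathrm{RP}}=\sqrt{1-\frac1{\kappa^2(\boldsymbol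 U)}}\qquad\text{and}\qquad\lim_{k\to\infty}\gamma_{\mathrm{NRP}}=\sqrt{1-\frac1{\kappa^2(\boldsymbol G)}}.$$
   Context: Let $\boldsymbol f=(f_1,\dots,f_m)^\top:\mathbb{R}^n\to\mathbb{R}^m$ with real-valued components $f_i$, let $\mathcal S_i=\{\boldsymbol x\in\mathbb{R}^n: f_i(\boldsymbol x)=0\}$ (not necessarily convex), and let $\boldsymbol x^*\in\cap_{i=1}^m\mathcal S_i$ be a solution of $\boldsymbol f(\boldsymbol x)=\boldsymbol 0$. $\nabla f_i(\boldsymbol x^* )$ is the gradient of $f_i$ at $\boldsymbol x^*$, assumed nonzero for every $i$. $\Pi_i(\boldsymbol z)=\arg\min_{\boldsymbol x\in\mathcal S_i}\|\boldsymbol x-\boldsymbol z\|_2^2$ is the projection of $\boldsymbol z\in\mathbb{R}^n$ onto $\mathcal S_i$. Standing assumption: every $\Pi_i$, $i=1,\dots,m$, is differentiable at $\boldsymbol x^*$. Both methods iterate $\boldsymbol x^{k+1}=\Pi_{i_k}(\boldsymbol x^k)$, $k=0,1,\dots$, with a randomly selected index $i_k$; $\mathbb{E}_{i_k}$ denotes expectation with respect to the random index $i_k$. Notation: $\boldsymbol U=\left[\frac{\nabla f_1(\boldsymbol x^* )}{\|\nabla f_1(\boldsymbol x^* )\|_2},\dots,\frac{\nabla f_m(\boldsymbol x^* )}{\|\nabla f_m(\boldsymbol x^* )\|_2}\right]\in\mathbb{R}^{n\times m}$; $\boldsymbol G=[\nabla f_1(\boldsymbol x^* ),\dots,\nabla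 f_m(\boldsymbol x^* )]\in\mathbb{R}^{n\times m}$ is the transpose of the Jacobian matrix of $\boldsymbol f$ at $\boldsymbol x^*$; $\kappa(\boldsymbol M)=\|\boldsymbol M\|_{\mathrm F}/\sigma_{\min}(\boldsymbol M)$ is the condition number, with $\|\cdot\|_{\mathrm F}$ the Frobenius norm and $\sigma_{\min}(\boldsymbol M)$ the minimum singular value, $\sigma_{\min}^2(\boldsymbol M)=\lambda_{\min}(\boldsymbol M\boldsymbol M^\top)$ for $\boldsymbol M\in\mathbb{R}^{n\times m}$. Convention on the asymptotic rate: the convergence rates $\gamma$ contain an arbitrarily small term $\epsilon>0$ that depends on the radius of the neighborhood of $\boldsymbol x^*$ and is regarded as tending to $0$ as the iterates approach $\boldsymbol x^*$; $\lim_{k\to\infty}\gamma$ is understood in this sense.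
   Formalization: As stated the bound can fail, since iterates may leave the neighborhood. Proved instead, for x^0 ≠ x*: the bound for all k on the event of not having left it; probability of never leaving tends to 1 as x^0→x*; the full bound for k<N on a neighborhood depending on N. *)

theory Defs
  imports "HOL-Analysis.Analysis" "HOL-Probability.Probability"
begin

definition zero_set :: "(real^'n \<Rightarrow> real^'m) \<Rightarrow> 'm \<Rightarrow> (real^'n) set" where
  "zero_set f i = {x. f x $ i = 0}"

text \<open>The argmin need not be a singleton, since the sets are not convex; \<open>P i z\<close> is an arbitrary
  selection from it, and only the existence of a minimizer is required.\<close>

definition is_projection_family ::
  "(real^'n \<Rightarrow> real^'m) \<Rightarrow> ('m \<Rightarrow> real^'n \<Rightarrow> real^'n) \<Rightarrow> bool" where
  "is_projection_family f P \<longleftrightarrow>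
     (\<forall>i z. is_arg_min (\<lambda>x. (norm (x - z))\<^sup>2) (\<lambda>x. x \<in> zero_set f i) (P i z))"

text \<open>The type \<open>real^'m^'n\<close> consists of the matrices with rows indexed by \<open>'n\<close> and columns
  indexed by \<open>'m\<close>.\<close>

definition matrix_of_columns :: "('m \<Rightarrow> real^'n) \<Rightarrow> real^'m^'n" where
  "matrix_of_columns v = (\<chi> r c. v c $ r)"

definition eigenvalues :: "real^'n^'n \<Rightarrow> real set" where
  "eigenvalues A = {l. \<exists>v. v \<noteq> 0 \<and> A *v v = l *\<^sub>R v}"

definition sigma_min :: "real^'m^'n \<Rightarrow> real" where
  "sigma_min M = sqrt (Min (eigenvalues (M ** transpose M)))"

text \<open>On \<open>real^'m^'n\<close> the library's \<open>norm\<close> is the Euclidean norm of the vector of Euclidean norms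
  of the rows, which is the Frobenius norm.\<close>

definition cond_number :: "real^'m^'n \<Rightarrow> real" where
  "cond_number M = norm M / sigma_min M"

text \<open>A sample \<open>\<omega>\<close> is the whole sequence of indices \<open>i\<^sub>0, i\<^sub>1, \<dots>\<close>, drawn independently from \<open>p\<close>.\<close>

definition index_seq :: "'m pmf \<Rightarrow> (nat \<Rightarrow> 'm) measure" where
  "index_seq p = PiM UNIV (\<lambda>_. measure_pmf p)"

primrec iterate ::
  "('m \<Rightarrow> real^'n \<Rightarrow> real^'n) \<Rightarrow> real^'n \<Rightarrow> (nat \<Rightarrow> 'm) \<Rightarrow> nat \<Rightarrow> real^'n" where
  "iterate P x0 \<omega> 0 = x0"
| "iterate P x0 \<omega> (Suc k) = P (\<omega> k) (iterate P x0 \<omega> k)"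

text \<open>Local linear convergence in expectation to \<open>xstar\<close> with rate \<open>\<gamma>\<close> on the ball of radius
  \<open>\<delta>\<close>. Projections onto nonconvex sets can increase the distance to \<open>xstar\<close>, and even from
  starting points arbitrarily close to \<open>xstar\<close> the iterates may leave the ball, and then approach
  another solution, with positive probability. Hence no choice of \<open>\<delta>\<close> makes the plain bound on the
  expected error hold for all \<open>k\<close>. The three clauses say:
  \<^item> for all \<open>k\<close>, the bound holds for the expectation over the event that the iterates have not left
    the ball before step \<open>k + 1\<close>;
  \<^item> the probability that the iterates never leave the ball tends to 1 as the starting point
    approaches \<open>xstar\<close>;
  \<^item> up to any prescribed number of steps, the bound holds for the unrestricted expectation if the
    starting point is close enough to \<open>xstar\<close>.

  The inequalities being strict, \<open>xstar\<close> itself is excluded as a starting point there.\<close>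

definition locally_converges_linearly ::
  "('m \<Rightarrow> real^'n \<Rightarrow> real^'n) \<Rightarrow> 'm pmf \<Rightarrow> real^'n \<Rightarrow> real \<Rightarrow> real \<Rightarrow> bool" where
  "locally_converges_linearly P p xstar \<delta> \<gamma> \<longleftrightarrow>
     (\<forall>x0 \<in> ball xstar \<delta> - {xstar}. \<forall>k.
        (\<integral>\<omega>. norm (iterate P x0 \<omega> (k + 1) - xstar)
              * indicator {\<omega>. \<forall>j\<le>k. iterate P x0 \<omega> j \<in> ball xstar \<delta>} \<omega> \<partial>index_seq p)
          < \<gamma> ^ (k + 1) * norm (x0 - xstar)) \<and>
     (\<forall>\<eta>>0. \<exists>\<delta>'. 0 < \<delta>' \<and> \<delta>' \<le> \<delta> \<and> (\<forall>x0 \<in> ball xstar \<delta>'.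
        measure (index_seq p) {\<omega>. \<forall>k. iterate P x0 \<omega> k \<in> ball xstar \<delta>} > 1 - \<eta>)) \<and>
     (\<forall>N. \<exists>\<delta>'. 0 < \<delta>' \<and> \<delta>' \<le> \<delta> \<and> (\<forall>x0 \<in> ball xstar \<delta>' - {xstar}. \<forall>k<N.
        (\<integral>\<omega>. norm (iterate P x0 \<omega> (k + 1) - xstar) \<partial>index_seq p)
          < \<gamma> ^ (k + 1) * norm (x0 - xstar)))"

end

theory Submission
  imports Defs
begin

text \<open>
  Near \<open>xstar\<close> the map \<open>P i\<close> acts like its derivative \<open>D\<close>, and \<open>D\<close> is controlled by two facts.
  The function \<open>f\<^sub>i\<close> vanishes on the range of \<open>P i\<close>, so \<open>D h\<close> is orthogonal to the gradient \<open>g\<^sub>i\<close>;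
  and \<open>P i z\<close> is a closest point to \<open>z\<close>, which survives linearization and makes \<open>D\<close> an orthogonal
  projection onto its range. Hence
  \<open>\<parallel>D h\<parallel>\<^sup>2 = \<parallel>h\<parallel>\<^sup>2 - \<parallel>h - D h\<parallel>\<^sup>2 \<le> \<parallel>h\<parallel>\<^sup>2 - (g\<^sub>i \<bullet> h)\<^sup>2 / \<parallel>g\<^sub>i\<parallel>\<^sup>2\<close>
  (\<open>projection_derivative_norm_le\<close>). Averaged over \<open>i\<close> with either choice of probabilities, the
  subtracted terms form the Rayleigh quotient of \<open>M M\<^sup>T\<close> divided by the squared Frobenius norm of \<open>M\<close>,
  with \<open>M = U\<close> or \<open>M = G\<close>. It is at least \<open>1 / \<kappa>(M)\<^sup>2\<close>, and Jensen's inequality turns the mean square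
  into a bound on the mean (\<open>linearized_mean_error_le\<close>).

  The linearization error is \<open>o(\<parallel>h\<parallel>)\<close>. It is absorbed into a rate \<open>\<gamma>(\<delta>)\<close> that exceeds
  \<open>sqrt (1 - 1 / \<kappa>\<^sup>2)\<close> by a quantity tending to \<open>0\<close> with the radius (\<open>rate_function_of_radius\<close>), such
  that one random step from any point of the ball of radius \<open>\<delta>\<close> other than \<open>xstar\<close> shrinks the error
  in mean by a factor less than \<open>\<gamma>(\<delta>)\<close>.

  From this one-step contraction the three clauses of local convergence follow by conditioning on
  the first index (\<open>locally_converges_linearly_of_step\<close>). The bound on the event of not having left
  the ball is an induction on the number of steps. The probability of ever leaving the ball is at
  most \<open>\<parallel>x0 - xstar\<parallel> / \<delta>\<close>, the maximal inequality for a nonnegative supermartingale. Finally, a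
  projection at most doubles the distance to \<open>xstar\<close>, so from a starting point within \<open>\<delta> / 2\<^sup>N\<close> the
  first \<open>N\<close> steps stay in the ball, and the restricted and the full expectation agree.
\<close>

section \<open>The least eigenvalue of a Gram matrix\<close>

lemma quadratic_nonneg_imp_linear_coeff_zero:
  fixes a b :: real
  assumes "\<And>t. 0 \<le> 2 * t * a + t\<^sup>2 * b"
  shows "a = 0"
proof (rule ccontr)
  assume "a \<noteq> 0"
  define c where "c = \<bar>b\<bar> + 1"
  have c: "c > 0" "b < c" by (auto simp: c_def)
  (* At t = - a / c the linear term dominates, because c > b. *)
  have "2 * (- a / c) * a + (- a / c)\<^sup>2 * b = (a\<^sup>2 / c) * (b / c - 2)"
    using c(1) by (simp add: field_simps power2_eq_square)
  moreover have "b / c - 2 < 0" using c by (simp add: field_simps)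
  moreover have "a\<^sup>2 / c > 0" using \<open>a \<noteq> 0\<close> c by simp
  ultimately have "2 * (- a / c) * a + (- a / c)\<^sup>2 * b < 0"
    by (simp only: mult_pos_neg)
  with assms[of "- a / c"] show False by simp
qed

lemma norm_add_scaleR_sq:
  fixes x y :: "'a::real_inner"
  shows "(norm (x + t *\<^sub>R y))\<^sup>2 = (norm x)\<^sup>2 + 2 * t * (y \<bullet> x) + t\<^sup>2 * (norm y)\<^sup>2"
  unfolding power2_norm_eq_inner inner_add_left inner_add_right inner_scaleR_left
    inner_scaleR_right inner_commute[of x y]
  by (simp add: power2_eq_square algebra_simps)

lemma inner_gram_matrix:
  fixes M :: "real^'m^'n"
  shows "x \<bullet> ((M ** transpose M) *v y) = (transpose M *v x) \<bullet> (transpose M *v y)"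
proof -
  have "(M ** transpose M) *v y = M *v (transpose M *v y)"
    by (simp only: matrix_vector_mul_assoc)
  then show ?thesis
    by (simp only: dot_lmul_matrix [symmetric] transpose_matrix_vector)
qed

lemma norm_transpose_sq_eigenvector:
  fixes M :: "real^'m^'n"
  assumes "(M ** transpose M) *v x = l *\<^sub>R x"
  shows "(norm (transpose M *v x))\<^sup>2 = l * (norm x)\<^sup>2"
proof -
  have "(norm (transpose M *v x))\<^sup>2 = x \<bullet> ((M ** transpose M) *v x)"
    by (simp only: inner_gram_matrix power2_norm_eq_inner)
  then show ?thesis
    by (simp add: assms power2_norm_eq_inner)
qed

text \<open>Eigenvectors of the symmetric matrix \<open>M M\<^sup>T\<close> for distinct eigenvalues are orthogonal. Finiteness
  is what gives the \<open>Min\<close> in the definition of the least singular value its meaning.\<close>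

lemma finite_eigenvalues_gram:
  fixes M :: "real^'m^'n"
  shows "finite (eigenvalues (M ** transpose M))"
proof -
  let ?A = "M ** transpose M"
  define ev where "ev l = (SOME v. v \<noteq> 0 \<and> ?A *v v = l *\<^sub>R v)" for l
  have ev: "ev l \<noteq> 0" "?A *v ev l = l *\<^sub>R ev l" if "l \<in> eigenvalues ?A" for l
    using someI_ex[of "\<lambda>v. v \<noteq> 0 \<and> ?A *v v = l *\<^sub>R v"] that
    unfolding ev_def eigenvalues_def by auto
  have orth: "ev k \<bullet> ev l = 0"
    if "k \<in> eigenvalues ?A" "l \<in> eigenvalues ?A" "k \<noteq> l" for k l
  proof -
    have "ev k \<bullet> (?A *v ev l) = ev l \<bullet> (?A *v ev k)"
      by (simp only: inner_gram_matrix inner_commute)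
    then have "l * (ev k \<bullet> ev l) = k * (ev k \<bullet> ev l)"
      using that ev by (simp add: inner_commute)
    then show ?thesis using that(3) by simp
  qed
  have "inj_on ev (eigenvalues ?A)"
  proof (rule inj_onI)
    fix k l assume kl: "k \<in> eigenvalues ?A" "l \<in> eigenvalues ?A" and eq: "ev k = ev l"
    show "k = l"
    proof (rule ccontr)
      assume "k \<noteq> l"
      from orth[OF kl this] eq ev(1)[OF kl(2)] show False by simp
    qed
  qed
  moreover have "finite (ev ` eigenvalues ?A)"
  proof (rule pairwise_orthogonal_imp_finite)
    show "pairwise orthogonal (ev ` eigenvalues ?A)"
      by (rule pairwise_imageI) (simp add: orthogonal_def orth)
  qed
  ultimately show ?thesis using finite_imageD by blast
qed

text \<open>The least eigenvalue of \<open>M M\<^sup>T\<close> is the minimum of \<open>\<parallel>M\<^sup>T h\<parallel>\<^sup>2\<close> on the unit sphere: perturbing a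
  minimizer \<open>v\<close> in the direction \<open>M M\<^sup>T v - \<mu> v\<close> shows that it is an eigenvector for the minimal
  value \<open>\<mu>\<close>.\<close>

lemma least_eigenvalue_gram:
  fixes M :: "real^'m^'n"
  defines "\<mu> \<equiv> Min (eigenvalues (M ** transpose M))"
  shows least_eigenvalue_gram_mem: "\<mu> \<in> eigenvalues (M ** transpose M)"
    and least_eigenvalue_gram_le: "\<mu> * (norm h)\<^sup>2 \<le> (norm (transpose M *v h))\<^sup>2"
proof -
  let ?A = "M ** transpose M" and ?T = "\<lambda>h. transpose M *v h"
  have cont: "continuous_on (sphere (0::real^'n) 1) (\<lambda>h. (norm (?T h))\<^sup>2)"
    by (intro continuous_intros linear_continuous_on_compose matrix_vector_mul_linear
        matrix_vector_mult_linear_continuous_on)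
  have "\<exists>v\<in>sphere (0::real^'n) 1. \<forall>h\<in>sphere 0 1. (norm (?T v))\<^sup>2 \<le> (norm (?T h))\<^sup>2"
    by (rule continuous_attains_inf[OF _ _ cont]) auto
  then obtain v :: "real^'n" where v: "norm v = 1"
    and min: "\<And>h. norm h = 1 \<Longrightarrow> (norm (?T v))\<^sup>2 \<le> (norm (?T h))\<^sup>2"
    by auto
  define \<nu> where "\<nu> = (norm (?T v))\<^sup>2"
  have bound: "\<nu> * (norm h)\<^sup>2 \<le> (norm (?T h))\<^sup>2" for h
  proof (cases "h = 0")
    case False
    have "?T (h /\<^sub>R norm h) = ?T h /\<^sub>R norm h"
      by (rule linear_scale) (rule matrix_vector_mul_linear)
    then have "\<nu> \<le> (norm (?T h))\<^sup>2 / (norm h)\<^sup>2"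
      using min[of "h /\<^sub>R norm h"] False
      by (simp add: \<nu>_def power_mult_distrib field_simps)
    then show ?thesis using False by (simp add: field_simps)
  qed simp
  define w where "w = ?A *v v - \<nu> *\<^sub>R v"
  have "0 \<le> 2 * t * (w \<bullet> w) + t\<^sup>2 * ((norm (?T w))\<^sup>2 - \<nu> * (norm w)\<^sup>2)" for t
  proof -
    have lin: "?T (v + t *\<^sub>R w) = ?T v + t *\<^sub>R ?T w"
      by (simp only: matrix_vector_right_distrib matrix_vector_mult_scaleR)
    have "(norm (?T (v + t *\<^sub>R w)))\<^sup>2
        = (norm (?T v))\<^sup>2 + 2 * t * (?T w \<bullet> ?T v) + t\<^sup>2 * (norm (?T w))\<^sup>2"
      unfolding lin by (rule norm_add_scaleR_sq)
    moreover have "(norm (v + t *\<^sub>R w))\<^sup>2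
        = (norm v)\<^sup>2 + 2 * t * (w \<bullet> v) + t\<^sup>2 * (norm w)\<^sup>2"
      by (rule norm_add_scaleR_sq)
    moreover have ww: "w \<bullet> w = ?T w \<bullet> ?T v - \<nu> * (w \<bullet> v)"
    proof -
      have "w \<bullet> w = w \<bullet> (?A *v v) - w \<bullet> (\<nu> *\<^sub>R v)"
        by (subst (2) w_def) (rule inner_diff_right)
      then show ?thesis by (simp only: inner_gram_matrix inner_scaleR_right)
    qed
    ultimately have "\<nu> * (1 + 2 * t * (w \<bullet> v) + t\<^sup>2 * (norm w)\<^sup>2)
        \<le> \<nu> + 2 * t * (?T w \<bullet> ?T v) + t\<^sup>2 * (norm (?T w))\<^sup>2"
      using bound[of "v + t *\<^sub>R w"] v by (simp only: \<nu>_def power_one)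
    then show ?thesis unfolding ww by (simp add: algebra_simps)
  qed
  then have "w \<bullet> w = 0" by (rule quadratic_nonneg_imp_linear_coeff_zero)
  then have "?A *v v = \<nu> *\<^sub>R v" by (simp add: w_def)
  moreover have "v \<noteq> 0" using v by auto
  ultimately have mem: "\<nu> \<in> eigenvalues ?A" by (auto simp: eigenvalues_def)
  have "\<nu> \<le> l" if "l \<in> eigenvalues ?A" for l
  proof -
    from that obtain x where x: "x \<noteq> 0" "?A *v x = l *\<^sub>R x" by (auto simp: eigenvalues_def)
    have "\<nu> * (norm x)\<^sup>2 \<le> l * (norm x)\<^sup>2"
      using bound[of x] norm_transpose_sq_eigenvector[OF x(2)] by simp
    then show ?thesis using x(1) by simp
  qed
  then have "\<mu> = \<nu>"
    unfolding \<mu>_def using mem by (intro Min_eqI finite_eigenvalues_gram) auto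
  then show "\<mu> \<in> eigenvalues ?A" "\<mu> * (norm h)\<^sup>2 \<le> (norm (?T h))\<^sup>2"
    using mem bound by auto
qed

section \<open>The condition number of a matrix of columns\<close>

lemma transpose_matrix_of_columns_nth:
  "(transpose (matrix_of_columns v) *v h) $ i = v i \<bullet> h"
  by (simp only: matrix_vector_mul_component)
     (simp add: transpose_def matrix_of_columns_def inner_vec_def)

lemma norm_transpose_matrix_of_columns_sq:
  "(norm (transpose (matrix_of_columns v) *v h))\<^sup>2 = (\<Sum>i\<in>UNIV. (v i \<bullet> h)\<^sup>2)"
  unfolding power2_norm_eq_inner
  by (simp only: inner_vec_def transpose_matrix_of_columns_nth) (simp add: power2_eq_square)

lemma norm_matrix_of_columns_sq:
  "(norm (matrix_of_columns v))\<^sup>2 = (\<Sum>i\<in>UNIV. (norm (v i))\<^sup>2)"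
  unfolding power2_norm_eq_inner
  by (simp add: inner_vec_def matrix_of_columns_def) (rule sum.swap)

text \<open>The transpose of a matrix of full row rank is injective. The rank hypothesis is used in this
  form, which is insensitive to rescaling the columns.\<close>

lemma columns_span_of_full_rank:
  fixes v :: "'m::finite \<Rightarrow> real^'n"
  assumes "rank (matrix_of_columns v) = CARD('n)" "\<And>i. v i \<bullet> h = 0"
  shows "h = 0"
proof -
  have "rank (transpose (matrix_of_columns v)) = CARD('n)"
    using assms(1) by (simp only: rank_transpose)
  then have inj: "inj (\<lambda>h. transpose (matrix_of_columns v) *v h)"
    by (simp only: full_rank_injective)
  have "transpose (matrix_of_columns v) *v h = transpose (matrix_of_columns v) *v 0"
    by (simp only: vec_eq_iff transpose_matrix_of_columns_nth) (simp add: assms(2))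
  with inj show ?thesis by (simp only: inj_eq)
qed

text \<open>The quotient \<open>1 / \<kappa>\<^sup>2\<close> is the least eigenvalue of the Gram matrix relative to its trace.
  Spanning columns make it positive, and Cauchy-Schwarz bounds it by one, so that the rate
  \<open>sqrt (1 - 1 / \<kappa>\<^sup>2)\<close> lies in \<open>[0, 1)\<close>.\<close>

lemma inverse_cond_number_sq:
  fixes v :: "'m::finite \<Rightarrow> real^'n"
  defines "c \<equiv> 1 / (cond_number (matrix_of_columns v))\<^sup>2"
    and "s \<equiv> \<Sum>i\<in>UNIV. (norm (v i))\<^sup>2"
  assumes span: "\<And>h. (\<And>i. v i \<bullet> h = 0) \<Longrightarrow> h = 0"
  shows inverse_cond_number_sq_pos: "0 < c"
    and inverse_cond_number_sq_le_1: "c \<le> 1"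
    and inverse_cond_number_sq_rayleigh: "c * (norm h)\<^sup>2 * s \<le> (\<Sum>i\<in>UNIV. (v i \<bullet> h)\<^sup>2)"
proof -
  let ?M = "matrix_of_columns v"
  define \<mu> where "\<mu> = Min (eigenvalues (?M ** transpose ?M))"
  obtain x where x: "x \<noteq> 0" "(?M ** transpose ?M) *v x = \<mu> *\<^sub>R x"
    using least_eigenvalue_gram_mem[of ?M] by (auto simp: eigenvalues_def \<mu>_def)
  have sum_x: "(\<Sum>i\<in>UNIV. (v i \<bullet> x)\<^sup>2) = \<mu> * (norm x)\<^sup>2"
    using norm_transpose_sq_eigenvector[OF x(2)]
    by (simp only: norm_transpose_matrix_of_columns_sq)
  obtain j where j: "v j \<bullet> x \<noteq> 0" using span x(1) by blast
  then have "0 < (\<Sum>i\<in>UNIV. (v i \<bullet> x)\<^sup>2)"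
    by (intro sum_pos2[of _ j]) auto
  then have "\<mu> > 0" using x(1) by (simp add: sum_x zero_less_mult_iff)
  have "v j \<noteq> 0" using j by auto
  then have "s > 0" unfolding s_def by (intro sum_pos2[of _ j]) auto
  have "\<mu> * (norm x)\<^sup>2 \<le> s * (norm x)\<^sup>2"
    unfolding sum_x[symmetric] s_def sum_distrib_right
    by (intro sum_mono) (metis Cauchy_Schwarz_ineq power2_norm_eq_inner)
  then have "\<mu> \<le> s" using x(1) by simp
  have c: "c = \<mu> / s"
    using \<open>\<mu> > 0\<close> \<open>s > 0\<close>
    by (simp add: c_def cond_number_def sigma_min_def power_divide norm_matrix_of_columns_sq
        \<mu>_def s_def)
  show "0 < c" "c \<le> 1"
    using \<open>\<mu> > 0\<close> \<open>s > 0\<close> \<open>\<mu> \<le> s\<close> by (auto simp: c)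
  show "c * (norm h)\<^sup>2 * s \<le> (\<Sum>i\<in>UNIV. (v i \<bullet> h)\<^sup>2)"
    using least_eigenvalue_gram_le[of ?M h] \<open>s > 0\<close>
    by (simp only: c norm_transpose_matrix_of_columns_sq \<mu>_def) simp
qed

section \<open>The derivative of a projection\<close>

lemma projection_is_arg_min:
  assumes "is_projection_family f P"
  shows "is_arg_min (\<lambda>x. (norm (x - z))\<^sup>2) (\<lambda>x. f x $ i = 0) (P i z)"
  using assms unfolding is_projection_family_def zero_set_def mem_Collect_eq by blast

lemma projection_mem_zero_set:
  assumes "is_projection_family f P"
  shows "f (P i z) $ i = 0"
  using projection_is_arg_min[OF assms, of z i] unfolding is_arg_min_def by blast

lemma projection_minimal:
  assumes "is_projection_family f P" "f x $ i = 0"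
  shows "norm (P i z - z) \<le> norm (x - z)"
proof -
  have "\<not> (norm (x - z))\<^sup>2 < (norm (P i z - z))\<^sup>2"
    using projection_is_arg_min[OF assms(1), of z i] assms(2)
    unfolding is_arg_min_def by blast
  then show ?thesis by (meson not_less norm_ge_zero power_strict_mono pos2)
qed

lemma projection_fixes_zero_set:
  assumes "is_projection_family f P" "f x $ i = 0"
  shows "P i x = x"
  using projection_minimal[OF assms, of x] by simp

text \<open>Since \<open>x\<close> itself competes in the minimization, a projection at most doubles the distance to
  a solution, at any distance from it.\<close>

lemma projection_dist_doubling:
  assumes "is_projection_family f P" "f x $ i = 0"
  shows "norm (P i z - x) \<le> 2 * norm (z - x)"
proof -
  have "norm (P i z - x) \<le> norm (P i z - z) + norm (z - x)"
    using norm_triangle_ineq[of "P i z - z" "z - x"] by simp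
  also have "norm (P i z - z) \<le> norm (z - x)"
    using projection_minimal[OF assms, of z] by (simp add: norm_minus_commute)
  finally show ?thesis by simp
qed

lemma has_derivative_directional_limit:
  fixes g :: "'a::real_normed_vector \<Rightarrow> 'b::real_normed_vector"
  assumes "(g has_derivative D) (at x)"
  shows "((\<lambda>t. (g (x + t *\<^sub>R h) - g x) /\<^sub>R t) \<longlongrightarrow> D h) (at 0)"
proof -
  interpret D: bounded_linear D using assms by (rule has_derivative_bounded_linear)
  have 1: "((\<lambda>t::real. x + t *\<^sub>R h) has_derivative (\<lambda>t. t *\<^sub>R h)) (at 0)"
    by (auto intro!: derivative_eq_intros)
  have "((\<lambda>t::real. g (x + t *\<^sub>R h)) has_derivative (\<lambda>t. D (t *\<^sub>R h))) (at 0)"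
    using has_derivative_compose[OF 1] assms by simp
  then have "((\<lambda>t::real. g (x + t *\<^sub>R h)) has_vector_derivative D h) (at 0)"
    by (simp add: has_vector_derivative_def D.scaleR)
  then have "((\<lambda>t. (g (x + t *\<^sub>R h) - g x - t *\<^sub>R D h) /\<^sub>R \<bar>t\<bar>) \<longlongrightarrow> 0) (at 0)"
    by (simp add: has_vector_derivative_def has_derivative_at2 divide_inverse_commute diff_diff_eq)
  then have "((\<lambda>t. norm ((g (x + t *\<^sub>R h) - g x) /\<^sub>R t - D h)) \<longlongrightarrow> 0) (at 0)"
  proof (rule Lim_transform_eventually[OF tendsto_norm_zero])
    show "\<forall>\<^sub>F t in at 0. norm ((g (x + t *\<^sub>R h) - g x - t *\<^sub>R D h) /\<^sub>R \<bar>t\<bar>)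
        = norm ((g (x + t *\<^sub>R h) - g x) /\<^sub>R t - D h)"
    proof (intro eventually_at_filter[THEN iffD2] always_eventually allI impI)
      fix t :: real assume "t \<noteq> 0"
      then have "(g (x + t *\<^sub>R h) - g x) /\<^sub>R t - D h = (g (x + t *\<^sub>R h) - g x - t *\<^sub>R D h) /\<^sub>R t"
        by (simp add: scaleR_diff_right)
      then show "norm ((g (x + t *\<^sub>R h) - g x - t *\<^sub>R D h) /\<^sub>R \<bar>t\<bar>)
        = norm ((g (x + t *\<^sub>R h) - g x) /\<^sub>R t - D h)" by simp
    qed
  qed
  then show ?thesis by (rule LIM_zero_cancel[OF tendsto_norm_zero_cancel])
qed

text \<open>The composite \<open>f\<^sub>i \<circ> P i\<close> vanishes identically, so the chain rule puts the range of the
  derivative of \<open>P i\<close> into the tangent hyperplane.\<close>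

lemma projection_derivative_tangent:
  assumes proj: "is_projection_family f P" and sol: "f x $ i = 0"
    and grad: "GDERIV (\<lambda>y. f y $ i) x :> g"
    and D: "(P i has_derivative D) (at x)"
  shows "g \<bullet> D h = 0"
proof -
  have "((\<lambda>y. f y $ i) has_derivative (\<lambda>h. h \<bullet> g)) (at (P i x))"
    using grad by (simp add: gderiv_def projection_fixes_zero_set[OF proj sol])
  from has_derivative_compose[OF D this]
  have "((\<lambda>y. 0) has_derivative (\<lambda>h. D h \<bullet> g)) (at x)"
    by (simp add: projection_mem_zero_set[OF proj])
  then have "(\<lambda>h. D h \<bullet> g) = (\<lambda>h. 0)"
    by (rule has_derivative_unique) simp
  then show ?thesis by (metis inner_commute)
qed

text \<open>The minimality of \<open>P i (x + t h)\<close> against the competitor \<open>P i (x + t k)\<close> becomes, after division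
  by \<open>t\<close> and letting \<open>t \<rightarrow> 0\<close>, the minimality of \<open>D h\<close> against \<open>D k\<close>. So \<open>D\<close> is the orthogonal projection
  onto its own range, which yields Pythagoras.\<close>

lemma projection_derivative_pythagoras:
  assumes proj: "is_projection_family f P" and sol: "f x $ i = 0"
    and D: "(P i has_derivative D) (at x)"
  shows "(norm (D h))\<^sup>2 = (norm h)\<^sup>2 - (norm (h - D h))\<^sup>2"
proof -
  interpret D: bounded_linear D using D by (rule has_derivative_bounded_linear)
  have min: "norm (D h - h) \<le> norm (D k - h)" for k
  proof (rule tendsto_le)
    let ?q = "\<lambda>k t. (P i (x + t *\<^sub>R k) - P i x) /\<^sub>R t"
    show "((\<lambda>t. norm (?q k t - h)) \<longlongrightarrow> norm (D k - h)) (at 0)"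
      "((\<lambda>t. norm (?q h t - h)) \<longlongrightarrow> norm (D h - h)) (at 0)"
      by (intro tendsto_intros has_derivative_directional_limit[OF D])+
    show "\<forall>\<^sub>F t in at 0. norm (?q h t - h) \<le> norm (?q k t - h)"
    proof (intro eventually_at_filter[THEN iffD2] always_eventually allI impI)
      fix t :: real assume "t \<noteq> 0"
      then have q: "norm (?q k t - h) = norm (P i (x + t *\<^sub>R k) - (x + t *\<^sub>R h)) / \<bar>t\<bar>" for k
      proof -
        have "?q k t - h = (P i (x + t *\<^sub>R k) - (x + t *\<^sub>R h)) /\<^sub>R t"
          using \<open>t \<noteq> 0\<close> by (simp add: projection_fixes_zero_set[OF proj sol] algebra_simps)
        then show ?thesis by (simp add: divide_inverse)
      qed
      show "norm (?q h t - h) \<le> norm (?q k t - h)"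
        unfolding q
        by (intro divide_right_mono projection_minimal[OF proj]
            projection_mem_zero_set[OF proj]) simp
    qed
  qed simp
  (* Competitors on the ray through D h suffice for the orthogonality of D h and h - D h. *)
  have "0 \<le> 2 * t * (D h \<bullet> (D h - h)) + t\<^sup>2 * (norm (D h))\<^sup>2" for t
  proof -
    have "D (h + t *\<^sub>R h) - h = (D h - h) + t *\<^sub>R D h"
      by (simp add: D.add D.scaleR)
    then have "(norm (D h - h))\<^sup>2 \<le> (norm ((D h - h) + t *\<^sub>R D h))\<^sup>2"
      using min[of "h + t *\<^sub>R h"] by (metis norm_ge_zero power_mono)
    also have "\<dots> = (norm (D h - h))\<^sup>2 + 2 * t * (D h \<bullet> (D h - h)) + t\<^sup>2 * (norm (D h))\<^sup>2"
      by (rule norm_add_scaleR_sq)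
    finally show ?thesis by simp
  qed
  then have "D h \<bullet> (D h - h) = 0" by (rule quadratic_nonneg_imp_linear_coeff_zero)
  then show ?thesis
    unfolding power2_norm_eq_inner
    by (simp add: inner_diff_left inner_diff_right inner_commute)
qed

text \<open>This is an inequality because the range of \<open>D\<close> can be a proper subspace of the tangent
  hyperplane: differentiability of \<open>f\<close> at the one point \<open>x\<close> allows its zero set to be \<open>{x}\<close>,
  and then \<open>D = 0\<close>.\<close>

lemma projection_derivative_norm_le:
  assumes proj: "is_projection_family f P" and sol: "f x $ i = 0"
    and grad: "GDERIV (\<lambda>y. f y $ i) x :> g" and "g \<noteq> 0"
    and D: "(P i has_derivative D) (at x)"
  shows "(norm (D h))\<^sup>2 \<le> (norm h)\<^sup>2 - (g \<bullet> h)\<^sup>2 / (norm g)\<^sup>2"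
proof -
  have "g \<bullet> h = g \<bullet> (h - D h)"
    using projection_derivative_tangent[OF proj sol grad D] by (simp add: inner_diff_right)
  then have "(g \<bullet> h)\<^sup>2 \<le> (norm g)\<^sup>2 * (norm (h - D h))\<^sup>2"
    by (metis Cauchy_Schwarz_ineq power2_norm_eq_inner)
  then have "(g \<bullet> h)\<^sup>2 / (norm g)\<^sup>2 \<le> (norm (h - D h))\<^sup>2"
    using \<open>g \<noteq> 0\<close> by (simp add: field_simps)
  then show ?thesis
    using projection_derivative_pythagoras[OF proj sol D, of h] by simp
qed

section \<open>The mean error after one step\<close>

definition mean_error_after_step ::
  "('m::finite \<Rightarrow> real^'n \<Rightarrow> real^'n) \<Rightarrow> 'm pmf \<Rightarrow> real^'n \<Rightarrow> real^'n \<Rightarrow> real" where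
  "mean_error_after_step P p xstar x = (\<Sum>i\<in>UNIV. pmf p i * norm (P i x - xstar))"

lemma mean_le_root_mean_square:
  fixes p :: "'m::finite pmf" and a :: "'m \<Rightarrow> real"
  shows "(\<Sum>i\<in>UNIV. pmf p i * a i) \<le> sqrt (\<Sum>i\<in>UNIV. pmf p i * (a i)\<^sup>2)"
proof (rule real_le_rsqrt)
  let ?m = "\<Sum>i\<in>UNIV. pmf p i * a i"
  have 1: "(\<Sum>i\<in>UNIV. pmf p i) = 1" by (rule sum_pmf_eq_1) auto
  have "0 \<le> (\<Sum>i\<in>UNIV. pmf p i * (a i - ?m)\<^sup>2)"
    by (intro sum_nonneg) auto
  also have "\<dots> = (\<Sum>i\<in>UNIV. pmf p i * (a i)\<^sup>2 - 2 * ?m * (pmf p i * a i) + ?m\<^sup>2 * pmf p i)"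
    by (intro sum.cong refl) (simp add: power2_diff algebra_simps)
  also have "\<dots> = (\<Sum>i\<in>UNIV. pmf p i * (a i)\<^sup>2) - 2 * ?m * ?m + ?m\<^sup>2 * 1"
    by (simp only: sum.distrib sum_subtractf sum_distrib_left[symmetric] 1)
  finally show "?m\<^sup>2 \<le> (\<Sum>i\<in>UNIV. pmf p i * (a i)\<^sup>2)"
    by (simp add: power2_eq_square)
qed

text \<open>With probabilities proportional to \<open>\<parallel>v\<^sub>i\<parallel>\<^sup>2\<close> the weight of \<open>(v\<^sub>i \<bullet> h)\<^sup>2 / \<parallel>v\<^sub>i\<parallel>\<^sup>2\<close> does not depend
  on \<open>i\<close>, so the mean loss is the Rayleigh quotient that the condition number bounds. Uniform
  sampling is the instance in which all \<open>v\<^sub>i\<close> are unit vectors.\<close>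

lemma linearized_mean_error_le:
  fixes v :: "'m::finite \<Rightarrow> real^'n" and p :: "'m pmf"
  assumes nz: "\<And>i. v i \<noteq> 0"
    and p: "\<And>i. pmf p i = (norm (v i))\<^sup>2 / (\<Sum>j\<in>UNIV. (norm (v j))\<^sup>2)"
    and span: "\<And>h. (\<And>i. v i \<bullet> h = 0) \<Longrightarrow> h = 0"
    and D: "\<And>i. (norm (D i h))\<^sup>2 \<le> (norm h)\<^sup>2 - (v i \<bullet> h)\<^sup>2 / (norm (v i))\<^sup>2"
  shows "(\<Sum>i\<in>UNIV. pmf p i * norm (D i h))
    \<le> sqrt (1 - 1 / (cond_number (matrix_of_columns v))\<^sup>2) * norm h"
proof -
  define c where "c = 1 / (cond_number (matrix_of_columns v))\<^sup>2"
  define s where "s = (\<Sum>i\<in>UNIV. (norm (v i))\<^sup>2)"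
  have "s > 0" unfolding s_def using nz by (intro sum_pos) auto
  have 1: "(\<Sum>i\<in>UNIV. pmf p i) = 1" by (rule sum_pmf_eq_1) auto
  have "(\<Sum>i\<in>UNIV. pmf p i * (norm (D i h))\<^sup>2)
      \<le> (\<Sum>i\<in>UNIV. pmf p i * ((norm h)\<^sup>2 - (v i \<bullet> h)\<^sup>2 / (norm (v i))\<^sup>2))"
    by (intro sum_mono mult_left_mono D) simp
  also have "\<dots> = (\<Sum>i\<in>UNIV. pmf p i * (norm h)\<^sup>2 - (v i \<bullet> h)\<^sup>2 / s)"
    using nz by (intro sum.cong refl) (simp add: p s_def[symmetric] right_diff_distrib)
  also have "\<dots> = (norm h)\<^sup>2 - (\<Sum>i\<in>UNIV. (v i \<bullet> h)\<^sup>2) / s"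
    by (simp add: sum_subtractf sum_distrib_right[symmetric] sum_divide_distrib 1)
  also have "\<dots> \<le> (norm h)\<^sup>2 - c * (norm h)\<^sup>2"
    using inverse_cond_number_sq_rayleigh[where v = v and h = h, OF span] \<open>s > 0\<close>
    by (simp add: c_def[symmetric] s_def[symmetric] field_simps)
  finally have "(\<Sum>i\<in>UNIV. pmf p i * (norm (D i h))\<^sup>2) \<le> (1 - c) * (norm h)\<^sup>2"
    by (simp add: algebra_simps)
  then have "sqrt (\<Sum>i\<in>UNIV. pmf p i * (norm (D i h))\<^sup>2) \<le> sqrt ((1 - c) * (norm h)\<^sup>2)"
    by (rule real_sqrt_le_mono)
  also have "\<dots> = sqrt (1 - c) * norm h" by (simp add: real_sqrt_mult)
  finally have "sqrt (\<Sum>i\<in>UNIV. pmf p i * (norm (D i h))\<^sup>2) \<le> sqrt (1 - c) * norm h" .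
  with mean_le_root_mean_square[of p "\<lambda>i. norm (D i h)"] show ?thesis
    by (simp add: c_def)
qed

lemma mean_error_after_step_le_linearized:
  fixes P :: "'m::finite \<Rightarrow> real^'n \<Rightarrow> real^'n"
  assumes fixed: "\<And>i. P i xstar = xstar"
    and D: "\<And>i. (P i has_derivative D i) (at xstar)"
    and le: "\<And>h. (\<Sum>i\<in>UNIV. pmf p i * norm (D i h)) \<le> s * norm h"
    and "\<epsilon> > 0"
  shows "\<exists>d>0. \<forall>x\<in>ball xstar d. mean_error_after_step P p xstar x \<le> (s + \<epsilon>) * norm (x - xstar)"
proof -
  have 1: "(\<Sum>i\<in>UNIV. pmf p i) = 1" by (rule sum_pmf_eq_1) auto
  have "\<forall>\<^sub>F x in nhds xstar. norm (P i x - xstar - D i (x - xstar)) \<le> \<epsilon> * norm (x - xstar)" for i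
    using D[of i] \<open>\<epsilon> > 0\<close> unfolding has_derivative_at_alt fixed eventually_nhds_metric dist_norm
    by blast
  then have "\<forall>\<^sub>F x in nhds xstar. \<forall>i.
      norm (P i x - xstar - D i (x - xstar)) \<le> \<epsilon> * norm (x - xstar)"
    by (rule eventually_all_finite)
  then obtain d where "d > 0" and d: "\<And>x i. dist x xstar < d \<Longrightarrow>
      norm (P i x - xstar - D i (x - xstar)) \<le> \<epsilon> * norm (x - xstar)"
    unfolding eventually_nhds_metric by blast
  have "mean_error_after_step P p xstar x \<le> (s + \<epsilon>) * norm (x - xstar)"
    if x: "x \<in> ball xstar d" for x
  proof -
    have "norm (P i x - xstar) \<le> norm (D i (x - xstar)) + \<epsilon> * norm (x - xstar)" for i
      using norm_triangle_ineq[of "D i (x - xstar)" "P i x - xstar - D i (x - xstar)"] d[of x i] x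
      by (simp add: dist_commute)
    then have "mean_error_after_step P p xstar x
        \<le> (\<Sum>i\<in>UNIV. pmf p i * (norm (D i (x - xstar)) + \<epsilon> * norm (x - xstar)))"
      unfolding mean_error_after_step_def by (intro sum_mono mult_left_mono) auto
    also have "\<dots> = (\<Sum>i\<in>UNIV. pmf p i * norm (D i (x - xstar))) + \<epsilon> * norm (x - xstar)"
      by (simp add: distrib_left sum.distrib sum_distrib_right[symmetric] 1)
    also have "\<dots> \<le> (s + \<epsilon>) * norm (x - xstar)"
      using le[of "x - xstar"] by (simp add: distrib_right)
    finally show ?thesis .
  qed
  with \<open>d > 0\<close> show ?thesis by blast
qed

text \<open>A family of bounds, one for each \<open>\<epsilon>\<close>, becomes a single rate function of the radius: the
  infimum of the admissible \<open>\<epsilon>\<close> tends to \<open>0\<close> with the radius, and adding the radius itself makes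
  the inequality strict, and the rate positive even when \<open>s = 0\<close>.\<close>

lemma rate_function_of_radius:
  fixes T :: "'a::real_normed_vector \<Rightarrow> real"
  assumes bound: "\<And>\<epsilon>. \<epsilon> > 0 \<Longrightarrow> \<exists>d>0. \<forall>x\<in>ball xstar d. T x \<le> (s + \<epsilon>) * norm (x - xstar)"
    and s: "0 \<le> s" "s < 1"
  shows "\<exists>\<delta>0>0. \<exists>\<gamma>. (\<forall>\<delta>. 0 < \<delta> \<and> \<delta> \<le> \<delta>0 \<longrightarrow> \<gamma> \<delta> \<in> {0<..<1} \<and>
           (\<forall>x\<in>ball xstar \<delta> - {xstar}. T x < \<gamma> \<delta> * norm (x - xstar))) \<and>
         (\<gamma> \<longlongrightarrow> s) (at_right 0)"
proof -
  define E where "E \<delta> = {\<epsilon>. 0 \<le> \<epsilon> \<and> (\<forall>x\<in>ball xstar \<delta>. T x \<le> (s + \<epsilon>) * norm (x - xstar))}" for \<delta>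
  define \<gamma> where "\<gamma> \<delta> = s + \<delta> + Inf (E \<delta>)" for \<delta>
  have bdd: "bdd_below (E \<delta>)" for \<delta> by (rule bdd_belowI[of _ 0]) (auto simp: E_def)
  have Inf_E: "\<exists>d>0. \<forall>\<delta>. 0 < \<delta> \<and> \<delta> \<le> d \<longrightarrow> \<epsilon> \<in> E \<delta> \<and> 0 \<le> Inf (E \<delta>) \<and> Inf (E \<delta>) \<le> \<epsilon>"
    if \<epsilon>: "\<epsilon> > 0" for \<epsilon>
  proof -
    obtain d where d: "d > 0" "\<forall>x\<in>ball xstar d. T x \<le> (s + \<epsilon>) * norm (x - xstar)"
      using bound[OF \<epsilon>] by blast
    have "\<epsilon> \<in> E \<delta> \<and> 0 \<le> Inf (E \<delta>) \<and> Inf (E \<delta>) \<le> \<epsilon>" if "\<delta> \<le> d" for \<delta>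
    proof -
      have mem: "\<epsilon> \<in> E \<delta>" using d(2) \<open>\<epsilon> > 0\<close> \<open>\<delta> \<le> d\<close> by (auto simp: E_def)
      moreover have "0 \<le> Inf (E \<delta>)"
        using mem by (intro cInf_greatest) (auto simp: E_def)
      ultimately show ?thesis using cInf_lower[OF mem bdd] by blast
    qed
    with d(1) show ?thesis by blast
  qed
  define \<epsilon>0 where "\<epsilon>0 = (1 - s) / 4"
  have \<epsilon>0: "\<epsilon>0 > 0" using s by (simp add: \<epsilon>0_def)
  obtain d0 where d0: "d0 > 0"
    "\<And>\<delta>. 0 < \<delta> \<Longrightarrow> \<delta> \<le> d0 \<Longrightarrow> \<epsilon>0 \<in> E \<delta> \<and> 0 \<le> Inf (E \<delta>) \<and> Inf (E \<delta>) \<le> \<epsilon>0"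
    using Inf_E[OF \<epsilon>0] by blast
  define \<delta>0 where "\<delta>0 = min d0 \<epsilon>0"
  have "\<delta>0 > 0" using d0(1) \<epsilon>0 by (simp add: \<delta>0_def)
  moreover have "\<gamma> \<delta> \<in> {0<..<1} \<and> (\<forall>x\<in>ball xstar \<delta> - {xstar}. T x < \<gamma> \<delta> * norm (x - xstar))"
    if \<delta>: "0 < \<delta>" "\<delta> \<le> \<delta>0" for \<delta>
  proof -
    have Inf: "\<epsilon>0 \<in> E \<delta>" "0 \<le> Inf (E \<delta>)" "Inf (E \<delta>) \<le> \<epsilon>0"
      using d0(2)[of \<delta>] \<delta> by (auto simp: \<delta>0_def)
    have "0 < \<gamma> \<delta>" using s \<delta> Inf by (simp add: \<gamma>_def)
    have "\<gamma> \<delta> \<le> s + 2 * \<epsilon>0" using \<delta> Inf by (simp add: \<gamma>_def \<delta>0_def)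
    also have "\<dots> < 1" using s by (simp add: \<epsilon>0_def field_simps)
    finally have "\<gamma> \<delta> < 1" .
    have "\<exists>\<epsilon>\<in>E \<delta>. \<epsilon> < Inf (E \<delta>) + \<delta>"
      using cInf_less_iff[of "E \<delta>" "Inf (E \<delta>) + \<delta>"] Inf(1) bdd \<delta>(1) by auto
    then obtain \<epsilon> where \<epsilon>: "\<epsilon> \<in> E \<delta>" "s + \<epsilon> < \<gamma> \<delta>" by (auto simp: \<gamma>_def)
    have "T x < \<gamma> \<delta> * norm (x - xstar)" if "x \<in> ball xstar \<delta> - {xstar}" for x
    proof -
      have "T x \<le> (s + \<epsilon>) * norm (x - xstar)" using \<epsilon>(1) that by (auto simp: E_def)
      also have "\<dots> < \<gamma> \<delta> * norm (x - xstar)" using \<epsilon>(2) that by simp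
      finally show ?thesis .
    qed
    with \<open>0 < \<gamma> \<delta>\<close> \<open>\<gamma> \<delta> < 1\<close> show ?thesis by simp
  qed
  moreover have "(\<gamma> \<longlongrightarrow> s) (at_right 0)"
  proof (rule tendstoI)
    fix e :: real assume "e > 0"
    then obtain d where d: "d > 0" "\<And>\<delta>. 0 < \<delta> \<Longrightarrow> \<delta> \<le> d \<Longrightarrow> 0 \<le> Inf (E \<delta>) \<and> Inf (E \<delta>) \<le> e / 2"
      using Inf_E[of "e / 2"] by auto
    have "dist (\<gamma> \<delta>) s < e" if "0 < \<delta>" "\<delta> < min d (e / 2)" for \<delta>
      using d(2)[of \<delta>] that by (auto simp: \<gamma>_def dist_real_def)
    then show "\<forall>\<^sub>F \<delta> in at_right 0. dist (\<gamma> \<delta>) s < e"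
      using d(1) \<open>e > 0\<close> unfolding eventually_at_right_field
      by (intro exI[of _ "min d (e / 2)"]) auto
  qed
  ultimately show ?thesis by blast
qed

section \<open>First-step analysis of the random iteration\<close>

lemma prob_space_index_seq: "prob_space (index_seq p)"
  unfolding index_seq_def by (rule prob_space_PiM) (rule prob_space_measure_pmf)

lemma space_index_seq: "space (index_seq p) = UNIV"
  by (simp add: index_seq_def space_PiM)

text \<open>The maps \<open>P i\<close> are arbitrary selections and may fail to be Borel measurable. This is harmless,
  because an iterate depends on finitely many indices from a finite type: it is measurable even with
  respect to the discrete sigma-algebra.\<close>

lemma measurable_iterate:
  fixes P :: "'m::finite \<Rightarrow> real^'n \<Rightarrow> real^'n"
  shows "(\<lambda>\<omega>. iterate P x \<omega> k) \<in> index_seq p \<rightarrow>\<^sub>M count_space UNIV"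
proof (induction k)
  case (Suc k)
  have "(\<lambda>\<omega>. \<omega> k) \<in> index_seq p \<rightarrow>\<^sub>M measure_pmf p"
    unfolding index_seq_def by (rule measurable_component_singleton) simp
  then have 1: "(\<lambda>\<omega>. \<omega> k) \<in> index_seq p \<rightarrow>\<^sub>M count_space UNIV" by simp
  have 2: "(\<lambda>\<omega>. P i (iterate P x \<omega> k)) \<in> index_seq p \<rightarrow>\<^sub>M count_space UNIV" for i
    by (rule measurable_compose[OF Suc]) simp
  show ?case
    using measurable_compose_countable[OF 2 1] by simp
qed simp

lemma iterate_case_nat: "iterate P x (case_nat i \<omega>) (Suc k) = iterate P (P i x) \<omega> k"
  by (induction k) simp_all

lemma finite_range_iterate:
  fixes P :: "'m::finite \<Rightarrow> real^'n \<Rightarrow> real^'n"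
  shows "finite (range (\<lambda>\<omega>. iterate P x \<omega> k))"
proof (induction k)
  case (Suc k)
  have "range (\<lambda>\<omega>. iterate P x \<omega> (Suc k)) \<subseteq> (\<Union>i. P i ` range (\<lambda>\<omega>. iterate P x \<omega> k))"
    by auto
  then show ?case by (rule finite_subset) (use Suc in simp)
qed simp

lemma norm_iterate_bounded:
  fixes P :: "'m::finite \<Rightarrow> real^'n \<Rightarrow> real^'n"
  shows "\<exists>B. \<forall>\<omega>. norm (iterate P x \<omega> k - xstar) \<le> B"
proof -
  have "bounded ((\<lambda>y. y - xstar) ` range (\<lambda>\<omega>. iterate P x \<omega> k))"
    by (intro finite_imp_bounded finite_imageI finite_range_iterate)
  then show ?thesis by (auto simp: bounded_iff)
qed

text \<open>Conditioning on the first index: the index sequence is its first entry followed by an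
  independent copy of itself.\<close>

lemma integral_index_seq_first_step:
  fixes p :: "'m::finite pmf" and F :: "(nat \<Rightarrow> 'm) \<Rightarrow> real"
  assumes F: "F \<in> borel_measurable (index_seq p)" and B: "\<And>\<omega>. \<bar>F \<omega>\<bar> \<le> B"
  shows "(\<integral>\<omega>. F \<omega> \<partial>index_seq p) = (\<Sum>i\<in>UNIV. pmf p i * (\<integral>\<omega>. F (case_nat i \<omega>) \<partial>index_seq p))"
proof -
  interpret seq: sequence_space "measure_pmf p" ..
  interpret pair: pair_prob_space "measure_pmf p" "index_seq p"
    by (intro pair_prob_space.intro pair_sigma_finite.intro prob_space_imp_sigma_finite
        prob_space_index_seq prob_space_measure_pmf)
  let ?M = "measure_pmf p \<Otimes>\<^sub>M index_seq p"
  let ?g = "\<lambda>(i, \<omega>). case_nat i \<omega>"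
  have g: "?g \<in> ?M \<rightarrow>\<^sub>M index_seq p"
    unfolding index_seq_def by measurable
  have Fg: "(\<lambda>x. F (?g x)) \<in> borel_measurable ?M"
    by (rule measurable_compose[OF g F])
  have "integrable ?M (\<lambda>x. F (?g x))"
    by (rule pair.integrable_const_bound[OF _ Fg, of B]) (simp add: B)
  have "(\<integral>\<omega>. F \<omega> \<partial>index_seq p) = (\<integral>\<omega>. F \<omega> \<partial>distr ?M (index_seq p) ?g)"
    using seq.PiM_iter by (simp add: index_seq_def)
  also have "\<dots> = (\<integral>x. F (?g x) \<partial>?M)" by (rule integral_distr[OF g F])
  also have "\<dots> = (\<integral>i. (\<integral>\<omega>. F (case_nat i \<omega>) \<partial>index_seq p) \<partial>measure_pmf p)"
    using pair.integral_fst'[OF \<open>integrable ?M (\<lambda>x. F (?g x))\<close>] by simp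
  also have "\<dots> = (\<Sum>i\<in>UNIV. pmf p i * (\<integral>\<omega>. F (case_nat i \<omega>) \<partial>index_seq p))"
    by (subst integral_measure_pmf[of UNIV]) simp_all
  finally show ?thesis .
qed

lemma all_le_Suc_iff: "(\<forall>j\<le>Suc k. Q j) \<longleftrightarrow> Q 0 \<and> (\<forall>j\<le>k. Q (Suc j))"
  by (metis Suc_le_mono not0_implies_Suc le0)

lemma measurable_stays_upto:
  fixes P :: "'m::finite \<Rightarrow> real^'n \<Rightarrow> real^'n"
  shows "{\<omega>. \<forall>j\<le>k. iterate P x \<omega> j \<in> A} \<in> sets (index_seq p)"
proof -
  have "{\<omega>. iterate P x \<omega> j \<in> A} \<in> sets (index_seq p)" for j
    using measurable_sets[OF measurable_iterate[of P x j p], of A]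
    by (simp add: space_index_seq vimage_def)
  then have "(\<Inter>j\<in>{..k}. {\<omega>. iterate P x \<omega> j \<in> A}) \<in> sets (index_seq p)"
    by (intro sets.finite_INT) auto
  moreover have "(\<Inter>j\<in>{..k}. {\<omega>. iterate P x \<omega> j \<in> A}) = {\<omega>. \<forall>j\<le>k. iterate P x \<omega> j \<in> A}"
    by auto
  ultimately show ?thesis by simp
qed

text \<open>Induction on the number of steps. After the first step the iteration restarts at \<open>P i x\<close>; if
  that point is outside the ball, the integrand vanishes, and otherwise the induction hypothesis
  applies to it. The mean error of the very first step stays unestimated in the bound, so that the
  strict inequality available for it carries over to all \<open>k\<close>.\<close>

lemma killed_expectation_le:
  fixes P :: "'m::finite \<Rightarrow> real^'n \<Rightarrow> real^'n"
  assumes "0 \<le> \<gamma>"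
    and step: "\<And>x. x \<in> ball xstar \<delta> \<Longrightarrow> mean_error_after_step P p xstar x \<le> \<gamma> * norm (x - xstar)"
    and "x \<in> ball xstar \<delta>"
  shows "(\<integral>\<omega>. norm (iterate P x \<omega> (k + 1) - xstar)
              * indicator {\<omega>. \<forall>j\<le>k. iterate P x \<omega> j \<in> ball xstar \<delta>} \<omega> \<partial>index_seq p)
          \<le> \<gamma> ^ k * mean_error_after_step P p xstar x"
proof -
  let ?A = "\<lambda>k x. {\<omega>. \<forall>j\<le>k. iterate P x \<omega> j \<in> ball xstar \<delta>}"
  let ?F = "\<lambda>k x \<omega>. norm (iterate P x \<omega> (k + 1) - xstar) * indicator (?A k x) \<omega>"
  interpret prob_space "index_seq p" by (rule prob_space_index_seq)
  have meas: "?F k x \<in> borel_measurable (index_seq p)" for k x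
    by (intro borel_measurable_times borel_measurable_indicator measurable_stays_upto
        measurable_compose[OF measurable_iterate]) simp
  have bounded: "\<exists>B. \<forall>\<omega>. \<bar>?F k x \<omega>\<bar> \<le> B" for k x
  proof -
    obtain B where B: "\<And>\<omega>. norm (iterate P x \<omega> (k + 1) - xstar) \<le> B"
      using norm_iterate_bounded by blast
    have "\<bar>?F k x \<omega>\<bar> \<le> B" for \<omega>
      using B[of \<omega>] norm_ge_zero[of "iterate P x \<omega> (k + 1) - xstar"]
      by (auto simp: indicator_def simp del: norm_ge_zero)
    then show ?thesis by blast
  qed
  have first: "(\<integral>\<omega>. ?F k x \<omega> \<partial>index_seq p)
      = (\<Sum>i\<in>UNIV. pmf p i * (\<integral>\<omega>. ?F k x (case_nat i \<omega>) \<partial>index_seq p))" for k x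
    using bounded[of x k] integral_index_seq_first_step[OF meas] by blast
  show ?thesis
    using \<open>x \<in> ball xstar \<delta>\<close>
  proof (induction k arbitrary: x)
    case 0
    then show ?case
      unfolding first mean_error_after_step_def by (simp add: prob_space)
  next
    case (Suc k)
    have "(\<integral>\<omega>. ?F (Suc k) x (case_nat i \<omega>) \<partial>index_seq p) \<le> \<gamma> ^ Suc k * norm (P i x - xstar)" for i
    proof -
      have ind: "case_nat i \<omega> \<in> ?A (Suc k) x \<longleftrightarrow> \<omega> \<in> ?A k (P i x)" for \<omega>
        using Suc.prems by (simp only: mem_Collect_eq all_le_Suc_iff iterate_case_nat) simp
      have shift: "?F (Suc k) x (case_nat i \<omega>) = ?F k (P i x) \<omega>" for \<omega>
        using ind[of \<omega>] iterate_case_nat[of P x i \<omega> "k + 1"]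
        by (simp add: indicator_def del: iterate.simps)
      show ?thesis
      proof (cases "P i x \<in> ball xstar \<delta>")
        case True
        have "(\<integral>\<omega>. ?F k (P i x) \<omega> \<partial>index_seq p) \<le> \<gamma> ^ k * mean_error_after_step P p xstar (P i x)"
          by (rule Suc.IH[OF True])
        also have "\<dots> \<le> \<gamma> ^ k * (\<gamma> * norm (P i x - xstar))"
          using \<open>0 \<le> \<gamma>\<close> by (intro mult_left_mono step True) simp
        finally show ?thesis by (simp only: shift) (simp add: mult_ac)
      next
        case False
        then have "?F k (P i x) \<omega> = 0" for \<omega>
          by (auto simp: indicator_def intro!: exI[of _ 0])
        then show ?thesis using \<open>0 \<le> \<gamma>\<close> by (simp only: shift) simp
      qed
    qed
    then have "(\<integral>\<omega>. ?F (Suc k) x \<omega> \<partial>index_seq p)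
        \<le> (\<Sum>i\<in>UNIV. pmf p i * (\<gamma> ^ Suc k * norm (P i x - xstar)))"
      unfolding first by (intro sum_mono mult_left_mono) auto
    also have "\<dots> = \<gamma> ^ Suc k * mean_error_after_step P p xstar x"
      by (simp add: mean_error_after_step_def sum_distrib_left mult_ac)
    finally show ?case .
  qed
qed

text \<open>The distance to \<open>xstar\<close>, stopped at the exit from the ball, is a nonnegative supermartingale,
  and it is at least \<open>\<delta>\<close> after the exit. The maximal inequality for it is proved directly, again by
  conditioning on the first step.\<close>

lemma prob_stays_upto_ge:
  fixes P :: "'m::finite \<Rightarrow> real^'n \<Rightarrow> real^'n"
  assumes "\<delta> > 0"
    and step: "\<And>x. x \<in> ball xstar \<delta> \<Longrightarrow> mean_error_after_step P p xstar x \<le> norm (x - xstar)"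
  shows "1 - norm (x - xstar) / \<delta>
    \<le> measure (index_seq p) {\<omega>. \<forall>j\<le>k. iterate P x \<omega> j \<in> ball xstar \<delta>}"
proof -
  let ?A = "\<lambda>k x. {\<omega>. \<forall>j\<le>k. iterate P x \<omega> j \<in> ball xstar \<delta>}"
  interpret prob_space "index_seq p" by (rule prob_space_index_seq)
  have outside: "1 - norm (x - xstar) / \<delta> \<le> measure (index_seq p) B"
    if "x \<notin> ball xstar \<delta>" for x B
  proof -
    have "1 \<le> norm (x - xstar) / \<delta>"
      using that \<open>\<delta> > 0\<close> by (simp add: dist_norm norm_minus_commute)
    then have "1 - norm (x - xstar) / \<delta> \<le> 0" by simp
    also have "0 \<le> measure (index_seq p) B" by simp
    finally show ?thesis .
  qed
  show ?thesis
  proof (induction k arbitrary: x)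
    case 0
    show ?case
    proof (cases "x \<in> ball xstar \<delta>")
      case True
      then have "?A 0 x = space (index_seq p)" by (simp add: space_index_seq)
      then show ?thesis using \<open>\<delta> > 0\<close> by (simp add: prob_space)
    qed (rule outside)
  next
    case (Suc k)
    show ?case
    proof (cases "x \<in> ball xstar \<delta>")
      case True
      have 1: "(\<Sum>i\<in>UNIV. pmf p i) = 1" by (rule sum_pmf_eq_1) auto
      have ind: "case_nat i \<omega> \<in> ?A (Suc k) x \<longleftrightarrow> \<omega> \<in> ?A k (P i x)" for i \<omega>
        using True by (simp only: mem_Collect_eq all_le_Suc_iff iterate_case_nat) simp
      have meas: "(indicator (?A (Suc k) x) :: _ \<Rightarrow> real) \<in> borel_measurable (index_seq p)"
        by (intro borel_measurable_indicator measurable_stays_upto)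
      have "measure (index_seq p) (?A (Suc k) x) = (\<integral>\<omega>. indicator (?A (Suc k) x) \<omega> \<partial>index_seq p)"
        by (simp add: space_index_seq)
      also have "\<dots> = (\<Sum>i\<in>UNIV. pmf p i * (\<integral>\<omega>. indicator (?A (Suc k) x) (case_nat i \<omega>) \<partial>index_seq p))"
        by (rule integral_index_seq_first_step[OF meas, of 1]) (simp add: indicator_def)
      also have "\<dots> = (\<Sum>i\<in>UNIV. pmf p i * measure (index_seq p) (?A k (P i x)))"
      proof (intro sum.cong refl arg_cong2[where f = "(*)"])
        fix i
        have "indicator (?A (Suc k) x) (case_nat i \<omega>) = (indicator (?A k (P i x)) \<omega> :: real)" for \<omega>
          using ind[of i \<omega>] by (simp add: indicator_def)
        then show "(\<integral>\<omega>. indicator (?A (Suc k) x) (case_nat i \<omega>) \<partial>index_seq p)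
            = measure (index_seq p) (?A k (P i x))"
          by (simp add: space_index_seq)
      qed
      finally have eq: "measure (index_seq p) (?A (Suc k) x)
        = (\<Sum>i\<in>UNIV. pmf p i * measure (index_seq p) (?A k (P i x)))" .
      have "1 - norm (x - xstar) / \<delta> \<le> 1 - mean_error_after_step P p xstar x / \<delta>"
        using step[OF True] \<open>\<delta> > 0\<close> by (simp add: divide_right_mono)
      also have "\<dots> = (\<Sum>i\<in>UNIV. pmf p i * (1 - norm (P i x - xstar) / \<delta>))"
        by (simp add: right_diff_distrib sum_subtractf 1 mean_error_after_step_def sum_divide_distrib)
      also have "\<dots> \<le> measure (index_seq p) (?A (Suc k) x)"
        unfolding eq by (intro sum_mono mult_left_mono Suc.IH) simp
      finally show ?thesis .
    qed (rule outside)
  qed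
qed

lemma prob_stays_forever_ge:
  fixes P :: "'m::finite \<Rightarrow> real^'n \<Rightarrow> real^'n"
  assumes "\<delta> > 0"
    and "\<And>x. x \<in> ball xstar \<delta> \<Longrightarrow> mean_error_after_step P p xstar x \<le> norm (x - xstar)"
  shows "1 - norm (x - xstar) / \<delta>
    \<le> measure (index_seq p) {\<omega>. \<forall>k. iterate P x \<omega> k \<in> ball xstar \<delta>}"
proof -
  let ?A = "\<lambda>k. {\<omega>. \<forall>j\<le>k. iterate P x \<omega> j \<in> ball xstar \<delta>}"
  interpret prob_space "index_seq p" by (rule prob_space_index_seq)
  have "(\<lambda>k. measure (index_seq p) (?A k)) \<longlonglongrightarrow> measure (index_seq p) (\<Inter>k. ?A k)"
  proof (rule finite_Lim_measure_decseq)
    show "range ?A \<subseteq> events" using measurable_stays_upto by blast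
    show "decseq ?A" by (force simp: decseq_def)
  qed
  moreover have "(\<Inter>k. ?A k) = {\<omega>. \<forall>k. iterate P x \<omega> k \<in> ball xstar \<delta>}" by auto
  ultimately show ?thesis
    using prob_stays_upto_ge[OF assms] by (intro LIMSEQ_le_const) auto
qed

lemma iterate_dist_le:
  assumes "\<And>i x. norm (P i x - xstar) \<le> L * norm (x - xstar)" "0 \<le> L"
  shows "norm (iterate P x \<omega> k - xstar) \<le> L ^ k * norm (x - xstar)"
proof (induction k)
  case (Suc k)
  have "norm (iterate P x \<omega> (Suc k) - xstar) \<le> L * norm (iterate P x \<omega> k - xstar)"
    using assms(1) by simp
  also have "\<dots> \<le> L * (L ^ k * norm (x - xstar))"
    using Suc assms(2) by (rule mult_left_mono)
  finally show ?case by simp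
qed simp

text \<open>Contraction inside the ball gives the first two clauses. Doubling bounds how
  far a fixed number of steps can lead, which reduces the third clause to the first.\<close>

lemma locally_converges_linearly_of_step:
  fixes P :: "'m::finite \<Rightarrow> real^'n \<Rightarrow> real^'n"
  assumes "\<delta> > 0" and \<gamma>: "\<gamma> \<in> {0<..<1}"
    and step: "\<And>x. x \<in> ball xstar \<delta> - {xstar} \<Longrightarrow> mean_error_after_step P p xstar x < \<gamma> * norm (x - xstar)"
    and doubling: "\<And>i x. norm (P i x - xstar) \<le> 2 * norm (x - xstar)"
  shows "locally_converges_linearly P p xstar \<delta> \<gamma>"
proof -
  have "mean_error_after_step P p xstar xstar = 0"
    using doubling[of _ xstar] by (simp add: mean_error_after_step_def)
  then have step_le: "mean_error_after_step P p xstar x \<le> \<gamma> * norm (x - xstar)"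
    if "x \<in> ball xstar \<delta>" for x
    using step[of x] that by (cases "x = xstar") auto
  have step_le': "mean_error_after_step P p xstar x \<le> norm (x - xstar)"
    if "x \<in> ball xstar \<delta>" for x
  proof -
    have "\<gamma> * norm (x - xstar) \<le> 1 * norm (x - xstar)"
      using \<gamma> by (intro mult_right_mono) auto
    with step_le[OF that] show ?thesis by simp
  qed
  have killed: "(\<integral>\<omega>. norm (iterate P x \<omega> (k + 1) - xstar)
              * indicator {\<omega>. \<forall>j\<le>k. iterate P x \<omega> j \<in> ball xstar \<delta>} \<omega> \<partial>index_seq p)
          < \<gamma> ^ (k + 1) * norm (x - xstar)"
    if x: "x \<in> ball xstar \<delta> - {xstar}" for x k
  proof -
    have "(\<integral>\<omega>. norm (iterate P x \<omega> (k + 1) - xstar)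
              * indicator {\<omega>. \<forall>j\<le>k. iterate P x \<omega> j \<in> ball xstar \<delta>} \<omega> \<partial>index_seq p)
          \<le> \<gamma> ^ k * mean_error_after_step P p xstar x"
      using \<gamma> x step_le by (intro killed_expectation_le) auto
    also have "\<dots> < \<gamma> ^ k * (\<gamma> * norm (x - xstar))"
      using \<gamma> step[OF x] by (intro mult_strict_left_mono) auto
    finally show ?thesis by (simp add: mult_ac)
  qed
  have stays: "\<exists>\<delta>'. 0 < \<delta>' \<and> \<delta>' \<le> \<delta> \<and> (\<forall>x\<in>ball xstar \<delta>'.
        measure (index_seq p) {\<omega>. \<forall>k. iterate P x \<omega> k \<in> ball xstar \<delta>} > 1 - \<eta>)"
    if "\<eta> > 0" for \<eta>
  proof (intro exI[of _ "min \<delta> (\<eta> * \<delta>)"] conjI ballI)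
    show "0 < min \<delta> (\<eta> * \<delta>)" "min \<delta> (\<eta> * \<delta>) \<le> \<delta>" using \<open>\<delta> > 0\<close> \<open>\<eta> > 0\<close> by auto
    fix x assume "x \<in> ball xstar (min \<delta> (\<eta> * \<delta>))"
    then have "norm (x - xstar) < \<eta> * \<delta>" by (simp add: dist_norm norm_minus_commute)
    then have "1 - \<eta> < 1 - norm (x - xstar) / \<delta>"
      using \<open>\<delta> > 0\<close> by (simp add: field_simps)
    also have "\<dots> \<le> measure (index_seq p) {\<omega>. \<forall>k. iterate P x \<omega> k \<in> ball xstar \<delta>}"
      using \<open>\<delta> > 0\<close> step_le' by (rule prob_stays_forever_ge)
    finally show "1 - \<eta> < measure (index_seq p) {\<omega>. \<forall>k. iterate P x \<omega> k \<in> ball xstar \<delta>}" .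
  qed
  have unrestricted: "\<exists>\<delta>'. 0 < \<delta>' \<and> \<delta>' \<le> \<delta> \<and> (\<forall>x\<in>ball xstar \<delta>' - {xstar}. \<forall>k<N.
        (\<integral>\<omega>. norm (iterate P x \<omega> (k + 1) - xstar) \<partial>index_seq p)
          < \<gamma> ^ (k + 1) * norm (x - xstar))" for N
  proof (intro exI[of _ "\<delta> / 2 ^ N"] conjI ballI allI impI)
    show "0 < \<delta> / 2 ^ N" "\<delta> / 2 ^ N \<le> \<delta>"
      using \<open>\<delta> > 0\<close> by (auto simp: field_simps)
    fix x k assume x: "x \<in> ball xstar (\<delta> / 2 ^ N) - {xstar}" and "k < N"
    (* Within N steps no sequence of indices can lead out of the larger ball. *)
    have "iterate P x \<omega> j \<in> ball xstar \<delta>" if "j \<le> N" for j \<omega>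
    proof -
      have "norm (iterate P x \<omega> j - xstar) \<le> 2 ^ j * norm (x - xstar)"
        using doubling by (rule iterate_dist_le) simp
      also have "\<dots> \<le> 2 ^ N * norm (x - xstar)"
        using that by (intro mult_right_mono power_increasing) auto
      also have "\<dots> < \<delta>"
        using x by (simp add: dist_norm norm_minus_commute field_simps)
      finally show ?thesis by (simp add: dist_norm norm_minus_commute)
    qed
    then have all: "{\<omega>. \<forall>j\<le>k. iterate P x \<omega> j \<in> ball xstar \<delta>} = UNIV"
      using \<open>k < N\<close> by auto
    have "x \<in> ball xstar \<delta> - {xstar}"
      using x \<open>\<delta> / 2 ^ N \<le> \<delta>\<close> by auto
    from killed[OF this, of k]
    show "(\<integral>\<omega>. norm (iterate P x \<omega> (k + 1) - xstar) \<partial>index_seq p) < \<gamma> ^ (k + 1) * norm (x - xstar)"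
      unfolding all by simp
  qed
  show ?thesis
    unfolding locally_converges_linearly_def using killed stays unrestricted by blast
qed

section \<open>Local linear convergence of the random projection methods\<close>

text \<open>Both sampling schemes are covered at once: the bound on the derivative depends on the gradients
  only through the lines that they span, so the columns \<open>v\<^sub>i\<close> may be scaled as the probabilities
  require: \<open>v\<^sub>i\<close> is the normalized gradient for uniform sampling, and the gradient otherwise.\<close>

lemma random_projections_converge_locally:
  fixes f :: "real^'n \<Rightarrow> real^'m" and v grad :: "'m \<Rightarrow> real^'n" and p :: "'m pmf"
  assumes sol: "\<And>i. f xstar $ i = 0"
    and grad: "\<And>i. GDERIV (\<lambda>x. f x $ i) xstar :> grad i"
    and proj: "is_projection_family f P"
    and diff: "\<And>i. P i differentiable (at xstar)"
    and v: "\<And>i. v i = a i *\<^sub>R grad i" and nz: "\<And>i. v i \<noteq> 0"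
    and p: "\<And>i. pmf p i = (norm (v i))\<^sup>2 / (\<Sum>j\<in>UNIV. (norm (v j))\<^sup>2)"
    and span: "\<And>h. (\<And>i. v i \<bullet> h = 0) \<Longrightarrow> h = 0"
  shows "\<exists>\<delta>0>0. \<exists>\<gamma>. (\<forall>\<delta>. 0 < \<delta> \<and> \<delta> \<le> \<delta>0 \<longrightarrow>
           \<gamma> \<delta> \<in> {0<..<1} \<and> locally_converges_linearly P p xstar \<delta> (\<gamma> \<delta>)) \<and>
         (\<gamma> \<longlongrightarrow> sqrt (1 - 1 / (cond_number (matrix_of_columns v))\<^sup>2)) (at_right 0)"
proof -
  define s where "s = sqrt (1 - 1 / (cond_number (matrix_of_columns v))\<^sup>2)"
  have s: "0 \<le> s" "s < 1"
    using inverse_cond_number_sq_pos[OF span] inverse_cond_number_sq_le_1[OF span]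
    by (auto simp: s_def)
  obtain D where D: "\<And>i. (P i has_derivative D i) (at xstar)"
    using diff unfolding differentiable_def by metis
  have "(norm (D i h))\<^sup>2 \<le> (norm h)\<^sup>2 - (v i \<bullet> h)\<^sup>2 / (norm (v i))\<^sup>2" for i h
  proof -
    have "grad i \<noteq> 0" "a i \<noteq> 0" using nz[of i] v[of i] by auto
    then have "(v i \<bullet> h)\<^sup>2 / (norm (v i))\<^sup>2 = (grad i \<bullet> h)\<^sup>2 / (norm (grad i))\<^sup>2"
      by (simp add: v power_mult_distrib)
    then show ?thesis
      using projection_derivative_norm_le[OF proj sol grad \<open>grad i \<noteq> 0\<close> D, of h] by simp
  qed
  then have lin: "(\<Sum>i\<in>UNIV. pmf p i * norm (D i h)) \<le> s * norm h" for h
    unfolding s_def by (intro linearized_mean_error_le nz p span)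
  have fixed: "P i xstar = xstar" for i
    using proj sol by (rule projection_fixes_zero_set)
  obtain \<delta>0 \<gamma> where "\<delta>0 > 0" and rate: "\<And>\<delta>. 0 < \<delta> \<and> \<delta> \<le> \<delta>0 \<Longrightarrow> \<gamma> \<delta> \<in> {0<..<1} \<and>
      (\<forall>x\<in>ball xstar \<delta> - {xstar}. mean_error_after_step P p xstar x < \<gamma> \<delta> * norm (x - xstar))"
    and lim: "(\<gamma> \<longlongrightarrow> s) (at_right 0)"
    using rate_function_of_radius[OF mean_error_after_step_le_linearized[OF fixed D lin] s]
    by blast
  have "locally_converges_linearly P p xstar \<delta> (\<gamma> \<delta>)" if "0 < \<delta>" "\<delta> \<le> \<delta>0" for \<delta>
    using rate[of \<delta>] that
    by (intro locally_converges_linearly_of_step projection_dist_doubling[OF proj sol]) auto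
  with \<open>\<delta>0 > 0\<close> rate lim show ?thesis unfolding s_def by blast
qed

theorem theorem4p3:
  fixes f :: "real^'n \<Rightarrow> real^'m"
    and xstar :: "real^'n"
    and grad :: "'m \<Rightarrow> real^'n"
    and P :: "'m \<Rightarrow> real^'n \<Rightarrow> real^'n"
    and U G :: "real^'m^'n"
    and p_RP p_NRP :: "'m pmf"
  assumes solution: "xstar \<in> (\<Inter>i. zero_set f i)"
    and gradient: "\<And>i. GDERIV (\<lambda>x. f x $ i) xstar :> grad i"
    and gradient_nz: "\<And>i. grad i \<noteq> 0"
    and projections: "is_projection_family f P"
    and projections_diff: "\<And>i. P i differentiable (at xstar)"
    and U_def: "U = matrix_of_columns (\<lambda>i. grad i /\<^sub>R norm (grad i))"
    and G_def: "G = matrix_of_columns grad"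
    and p_RP: "p_RP = pmf_of_set UNIV"
    and p_NRP: "\<And>i. pmf p_NRP i = (norm (grad i))\<^sup>2 / (\<Sum>j\<in>UNIV. (norm (grad j))\<^sup>2)"
    and rank_U: "rank U = CARD('n)"
  shows "\<exists>\<delta>0>0. \<exists>\<gamma>_RP \<gamma>_NRP :: real \<Rightarrow> real.
      (\<forall>\<delta>. 0 < \<delta> \<and> \<delta> \<le> \<delta>0 \<longrightarrow>
         \<gamma>_RP \<delta> \<in> {0<..<1} \<and> locally_converges_linearly P p_RP xstar \<delta> (\<gamma>_RP \<delta>) \<and>
         \<gamma>_NRP \<delta> \<in> {0<..<1} \<and> locally_converges_linearly P p_NRP xstar \<delta> (\<gamma>_NRP \<delta>)) \<and>
      (\<gamma>_RP \<longlongrightarrow> sqrt (1 - 1 / (cond_number U)\<^sup>2)) (at_right 0) \<and>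
      (\<gamma>_NRP \<longlongrightarrow> sqrt (1 - 1 / (cond_number G)\<^sup>2)) (at_right 0)"
proof -
  have sol: "f xstar $ i = 0" for i
    using solution unfolding zero_set_def by blast
  let ?u = "\<lambda>i. grad i /\<^sub>R norm (grad i)"
  have span_U: "h = 0" if "\<And>i. ?u i \<bullet> h = 0" for h
    using rank_U that unfolding U_def by (rule columns_span_of_full_rank)
  have span_G: "h = 0" if "\<And>i. grad i \<bullet> h = 0" for h
    using span_U[of h] that by simp
  have RP: "\<exists>\<delta>0>0. \<exists>\<gamma>. (\<forall>\<delta>. 0 < \<delta> \<and> \<delta> \<le> \<delta>0 \<longrightarrow>
      \<gamma> \<delta> \<in> {0<..<1} \<and> locally_converges_linearly P p_RP xstar \<delta> (\<gamma> \<delta>)) \<and>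
      (\<gamma> \<longlongrightarrow> sqrt (1 - 1 / (cond_number U)\<^sup>2)) (at_right 0)"
    unfolding U_def
  proof (rule random_projections_converge_locally[OF sol gradient projections projections_diff])
    show "?u i = inverse (norm (grad i)) *\<^sub>R grad i" for i by simp
    show "?u i \<noteq> 0" for i using gradient_nz by simp
    show "pmf p_RP i = (norm (?u i))\<^sup>2 / (\<Sum>j\<in>UNIV. (norm (?u j))\<^sup>2)" for i
      using gradient_nz by (simp add: p_RP)
    show "h = 0" if "\<And>i. ?u i \<bullet> h = 0" for h using that by (rule span_U)
  qed
  have NRP: "\<exists>\<delta>0>0. \<exists>\<gamma>. (\<forall>\<delta>. 0 < \<delta> \<and> \<delta> \<le> \<delta>0 \<longrightarrow>
      \<gamma> \<delta> \<in> {0<..<1} \<and> locally_converges_linearly P p_NRP xstar \<delta> (\<gamma> \<delta>)) \<and>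
      (\<gamma> \<longlongrightarrow> sqrt (1 - 1 / (cond_number G)\<^sup>2)) (at_right 0)"
    unfolding G_def
  proof (rule random_projections_converge_locally[OF sol gradient projections projections_diff])
    show "grad i = 1 *\<^sub>R grad i" for i by simp
    show "h = 0" if "\<And>i. grad i \<bullet> h = 0" for h using that by (rule span_G)
  qed (rule gradient_nz p_NRP)+
  obtain \<delta>1 \<gamma>1 where 1: "\<delta>1 > 0"
    "\<And>\<delta>. 0 < \<delta> \<and> \<delta> \<le> \<delta>1 \<Longrightarrow> \<gamma>1 \<delta> \<in> {0<..<1} \<and> locally_converges_linearly P p_RP xstar \<delta> (\<gamma>1 \<delta>)"
    "(\<gamma>1 \<longlongrightarrow> sqrt (1 - 1 / (cond_number U)\<^sup>2)) (at_right 0)"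
    using RP by blast
  obtain \<delta>2 \<gamma>2 where 2: "\<delta>2 > 0"
    "\<And>\<delta>. 0 < \<delta> \<and> \<delta> \<le> \<delta>2 \<Longrightarrow> \<gamma>2 \<delta> \<in> {0<..<1} \<and> locally_converges_linearly P p_NRP xstar \<delta> (\<gamma>2 \<delta>)"
    "(\<gamma>2 \<longlongrightarrow> sqrt (1 - 1 / (cond_number G)\<^sup>2)) (at_right 0)"
    using NRP by blast
  show ?thesis
    using 1 2 by (intro exI[of _ "min \<delta>1 \<delta>2"] exI[of _ \<gamma>1] exI[of _ \<gamma>2]) auto
qed

end
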